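(* There exist absolute constants $B_3',B_4',B_5'>0$ such that the following holds. Let $\nu>0$ and let $N\ge 2$ be an integer. Assume $u_0\in H^1(\mathbb T^3)$ is real-valued and has mean zero, let $u^0=\Pi_Nu_0$, and assume $\|u^0\|_{L^\infty(\mathbb T^3)}=L_0<\infty$ with $L_0\ne0$. Put $E_0=\mathcal E(u^0)$, $$\beta_3=B_3'\sqrt{E_0},\qquad \beta_4=B_4'E_0^{\frac32},\qquad \beta_5=B_5'(1+E_0)^{\frac14},$$ $$\tau_{\max}=\min\Big\{\frac{8\nu}{9L_0^4},\ \tau_{\max}^{(1)}\Big\},\qquad \tau_{\max}^{(1)}=0.0007\,\nu^7\min\{\beta_3^{-8},\ \beta_4^{-\frac83},\ \beta_5^{-8}\}.$$ Then for any $0<\tau\le\tau_{\max}$, the solution of the scheme $$\frac{u^{n+1}-u^n}{\tau}=-\nu\Delta^2u^{n+1}+\Delta\Pi_N(f(u^n)),\quad n\ge 0,$$ satisfies $\mathcal E(u^{n+1})\le\mathcal E(u^n)$ for all $n\ge 0$.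
   Context: $\mathbb T^3=\mathbb R^3/\mathbb Z^3=[-\frac12,\frac12)^3$ is the $1$-periodic torus. $f(u)=u^3-u$. The energy is $$\mathcal E(u)=\int_{\mathbb T^3}\Big(\tfrac12\nu|\nabla u|^2+\tfrac14(u^2-1)^2\Big)dx .$$ $\Pi_N$ is the $L^2$-projection onto $X_N=\operatorname{Span}\{\cos(2\pi k\cdot x),\sin(2\pi k\cdot x):k\in\mathbb Z^3,\ |k|_\infty\le N\}$, where $|k|_\infty=\max_j|k_j|$; i.e. $\Pi_N$ truncates to Fourier modes ($e^{2\pi i k\cdot x}$) with $|k|_\infty\le N$. Each $u^{n+1}\in X_N$ is uniquely determined by $u^n$ through the scheme. *)

theory Defs
  imports "HOL-Analysis.Analysis" "HOL-Probability.Essential_Supremum"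
begin

(* Functions on the torus R^3/Z^3 are 1-periodic functions on R^3; integrals and
   essential suprema over the torus are taken over the fundamental cell [-1/2,1/2)^3. *)

definition torus_cell :: "(real ^ 3) set" where
  "torus_cell = {x. \<forall>i. -1/2 \<le> x $ i \<and> x $ i < 1/2}"

definition torus_periodic :: "(real ^ 3 \<Rightarrow> 'a) \<Rightarrow> bool" where
  "torus_periodic u \<longleftrightarrow> (\<forall>x. \<forall>k :: int ^ 3. u (x + (\<chi> i. real_of_int (k $ i))) = u x)"

definition torus_integral :: "(real ^ 3 \<Rightarrow> 'a::{banach, second_countable_topology}) \<Rightarrow> 'a" where
  "torus_integral g = (LINT x:torus_cell|lebesgue. g x)"

definition Linf_norm :: "(real ^ 3 \<Rightarrow> real) \<Rightarrow> ereal" where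
  "Linf_norm u = esssup (restrict_space lebesgue torus_cell) (\<lambda>x. ereal \<bar>u x\<bar>)"

definition freq_dot :: "int ^ 3 \<Rightarrow> real ^ 3 \<Rightarrow> real" where
  "freq_dot k x = (\<Sum>i\<in>UNIV. real_of_int (k $ i) * x $ i)"

definition fourier_coeff :: "(real ^ 3 \<Rightarrow> real) \<Rightarrow> int ^ 3 \<Rightarrow> complex" where
  "fourier_coeff u k =
     torus_integral (\<lambda>x. complex_of_real (u x) * exp (- 2 * of_real pi * \<i> * of_real (freq_dot k x)))"

(* Real-valued L^2, and H^1 in the usual Fourier form on the torus. *)

definition L2_torus :: "(real ^ 3 \<Rightarrow> real) \<Rightarrow> bool" where
  "L2_torus u \<longleftrightarrow> torus_periodic u \<and> u \<in> borel_measurable lebesgue \<and>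
     set_integrable lebesgue torus_cell (\<lambda>x. (u x)\<^sup>2)"

definition H1_torus :: "(real ^ 3 \<Rightarrow> real) \<Rightarrow> bool" where
  "H1_torus u \<longleftrightarrow> L2_torus u \<and>
     (\<lambda>k :: int ^ 3. (1 + (\<Sum>i\<in>UNIV. (real_of_int (k $ i))\<^sup>2)) * (cmod (fourier_coeff u k))\<^sup>2)
       summable_on UNIV"

definition freqs :: "nat \<Rightarrow> (int ^ 3) set" where
  "freqs N = {k. \<forall>i. \<bar>k $ i\<bar> \<le> int N}"

(* The linear span is written out, since functions are not an instance of real_vector. *)

definition X_space :: "nat \<Rightarrow> (real ^ 3 \<Rightarrow> real) set" where
  "X_space N = {\<lambda>x. \<Sum>k\<in>freqs N. a k * cos (2 * pi * freq_dot k x) + b k * sin (2 * pi * freq_dot k x)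
                 | a b. True}"

(* For real u the frequencies k and -k contribute complex conjugates, so the truncated
   sum is real and Re only changes the type. *)

definition proj :: "nat \<Rightarrow> (real ^ 3 \<Rightarrow> real) \<Rightarrow> real ^ 3 \<Rightarrow> real" where
  "proj N u x =
     Re (\<Sum>k\<in>freqs N. fourier_coeff u k * exp (2 * of_real pi * \<i> * of_real (freq_dot k x)))"

(* Classical derivatives: these operators, and hence the energy, are only
   meaningful on smooth functions; below they are applied to trigonometric polynomials. *)

definition partial_deriv :: "3 \<Rightarrow> (real ^ 3 \<Rightarrow> real) \<Rightarrow> real ^ 3 \<Rightarrow> real" where
  "partial_deriv i u x = deriv (\<lambda>t. u (x + t *\<^sub>R axis i 1)) 0"

definition grad :: "(real ^ 3 \<Rightarrow> real) \<Rightarrow> real ^ 3 \<Rightarrow> real ^ 3" where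
  "grad u x = (\<chi> i. partial_deriv i u x)"

definition laplacian :: "(real ^ 3 \<Rightarrow> real) \<Rightarrow> real ^ 3 \<Rightarrow> real" where
  "laplacian u x = (\<Sum>i\<in>UNIV. partial_deriv i (partial_deriv i u) x)"

definition energy :: "real \<Rightarrow> (real ^ 3 \<Rightarrow> real) \<Rightarrow> real" where
  "energy \<nu> u = torus_integral (\<lambda>x. 1/2 * \<nu> * (norm (grad u x))\<^sup>2 + 1/4 * ((u x)\<^sup>2 - 1)\<^sup>2)"

definition nonlin :: "real \<Rightarrow> real" where
  "nonlin s = s ^ 3 - s"

definition scheme_solution ::
  "real \<Rightarrow> real \<Rightarrow> nat \<Rightarrow> (real ^ 3 \<Rightarrow> real) \<Rightarrow> (nat \<Rightarrow> real ^ 3 \<Rightarrow> real) \<Rightarrow> bool" where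
  "scheme_solution \<nu> \<tau> N u0 u \<longleftrightarrow>
     u 0 = proj N u0 \<and>
     (\<forall>n. u (Suc n) \<in> X_space N \<and>
       (\<forall>x. (u (Suc n) x - u n x) / \<tau> =
              - \<nu> * laplacian (laplacian (u (Suc n))) x
              + laplacian (proj N (\<lambda>y. nonlin (u n y))) x))"

end

theory Submission
  imports Defs
begin

text \<open>
  Write \<open>\<delta> = u\<^sup>n\<^sup>+\<^sup>1 - u\<^sup>n\<close>. Testing the scheme with \<open>(-\<Delta>)\<^sup>-\<^sup>1 \<delta>\<close> and Taylor
  expanding the potential gives the energy balance
  \<open>E(u\<^sup>n\<^sup>+\<^sup>1) - E(u\<^sup>n) \<le> - \<parallel>(-\<Delta>)\<^sup>-\<^sup>1\<^sup>/\<^sup>2 \<delta>\<parallel>\<^sup>2 / \<tau> - \<nu>/2 \<parallel>\<nabla>\<delta>\<parallel>\<^sup>2 + 3/2 M \<parallel>\<delta>\<parallel>\<^sup>2\<close>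
  as soon as \<open>|u\<^sup>n|\<^sup>2\<close> and \<open>|u\<^sup>n\<^sup>+\<^sup>1|\<^sup>2\<close> are bounded by \<open>M\<close>. In each Fourier mode the two negative
  terms together dominate \<open>sqrt (2\<nu>/\<tau>) |\<delta>\<^sub>k|\<^sup>2\<close> by the inequality of the arithmetic and geometric
  means, so the energy decreases whenever \<open>M = 2/3 sqrt (2\<nu>/\<tau>)\<close> is such a bound (energy_step).

  It remains to propagate the bound \<open>|u\<^sup>n|\<^sup>2 \<le> M\<close>. At \<open>n = 0\<close> it is exactly the restriction
  \<open>\<tau> \<le> 8\<nu> / (9 L\<^sub>0\<^sup>4)\<close>. For the induction step (sup_bound_step) put \<open>a = (\<tau>\<nu>)\<^sup>1\<^sup>/\<^sup>4\<close>, let \<open>\<lambda>\<close> be the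
  eigenvalues of \<open>-\<Delta>\<close>, and solve the scheme mode by mode:
  \<open>(1 + a\<^sup>4\<lambda>\<^sup>2) u\<^sup>n\<^sup>+\<^sup>1\<^sub>k = u\<^sup>n\<^sub>k - \<tau>\<lambda> f(u\<^sup>n)\<^sub>k\<close>.
  The denominator smooths at wave numbers beyond \<open>1/a\<close>, so that the \<open>\<ell>\<^sup>1\<close> norm of the coefficients
  of \<open>u\<^sup>n\<^sup>+\<^sup>1\<close>, and with it the supremum of \<open>|u\<^sup>n\<^sup>+\<^sup>1|\<close>, is controlled through Cauchy-Schwarz by
  \<open>\<parallel>\<nabla>u\<^sup>n\<parallel>\<^sup>2 / a\<close> and \<open>\<tau>\<^sup>2 \<parallel>f(u\<^sup>n)\<parallel>\<^sup>2 / a\<^sup>7\<close> up to absolute factors (step_norm_bound). The energy bounds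
  \<open>\<parallel>\<nabla>u\<^sup>n\<parallel>\<^sup>2\<close> by \<open>2E\<^sub>0/\<nu>\<close>. For the nonlinearity, \<open>f(u)\<^sup>2 = u\<^sup>2 (u\<^sup>2 - 1)\<^sup>2\<close>, so
  the induction hypothesis bounds the first factor and the energy the integral of the second: \<open>\<parallel>f(u\<^sup>n)\<parallel>\<^sup>2 \<le> 4 E\<^sub>0 M\<close>. With
  \<open>q = E\<^sub>0 a / \<nu>\<^sup>2\<close> both contributions are an absolute constant times \<open>q M\<close>, and
  \<open>q\<^sup>4 = E\<^sub>0\<^sup>4 \<tau> / \<nu>\<^sup>7\<close> is as small as desired once \<open>\<tau> \<le> 0.0007 \<nu>\<^sup>7 \<beta>\<^sub>3\<^sup>-\<^sup>8\<close> with \<open>B\<^sub>3\<close> large.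
\<close>

section \<open>Integration over the torus\<close>

abbreviation torus_measure :: "(real ^ 3) measure" where
  "torus_measure \<equiv> lebesgue_on torus_cell"

definition wave :: "int ^ 3 \<Rightarrow> real ^ 3 \<Rightarrow> complex" where
  "wave k x = cis (2 * pi * freq_dot k x)"

lemma torus_cell_borel: "torus_cell \<in> sets borel"
proof -
  have "torus_cell = (\<Inter>i. {x. -1/2 \<le> x $ i} \<inter> {x. x $ i < 1/2})"
    by (auto simp: torus_cell_def)
  also have "\<dots> \<in> sets borel"
    by (intro sets.finite_INT sets.Int borel_closed borel_open closed_Collect_le open_Collect_less
        continuous_intros) auto
  finally show ?thesis .
qed

lemma torus_cell_subset: "torus_cell \<subseteq> cbox (\<chi> i. -1/2) (\<chi> i. 1/2)"
  by (auto simp: torus_cell_def mem_box_cart less_imp_le)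

lemma torus_integral_eq: "torus_integral g = (\<integral>x. g x \<partial>torus_measure)"
  unfolding torus_integral_def set_lebesgue_integral_def
  by (subst integral_restrict_space) (use torus_cell_borel in auto)

lemma finite_torus_measure: "finite_measure torus_measure"
proof
  have "emeasure lebesgue torus_cell \<le> emeasure lebesgue (cbox (\<chi> i. -1/2) (\<chi> i. 1/2) :: (real ^ 3) set)"
    using torus_cell_subset by (intro emeasure_mono) auto
  also have "\<dots> < \<infinity>"
    using emeasure_lborel_cbox_finite by (simp add: emeasure_completion)
  finally show "emeasure torus_measure (space torus_measure) \<noteq> \<infinity>"
    using torus_cell_borel by (simp add: emeasure_restrict_space)
qed

lemma continuous_integrable_torus:
  fixes g :: "real ^ 3 \<Rightarrow> 'a::euclidean_space"
  assumes "continuous_on UNIV g"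
  shows "integrable torus_measure g"
proof -
  have "compact (g ` cbox (\<chi> i. -1/2) (\<chi> i. 1/2))"
    by (intro compact_continuous_image continuous_on_subset[OF assms]) auto
  then obtain B where B: "norm (g x) \<le> B" if "x \<in> cbox (\<chi> i. -1/2) (\<chi> i. 1/2)" for x
    by (meson compact_imp_bounded bounded_iff imageI)
  have "g \<in> borel_measurable lebesgue"
    using assms by (simp add: borel_measurable_continuous_onI measurable_completion)
  then have "g \<in> borel_measurable torus_measure"
    by (rule measurable_restrict_space1)
  moreover have "AE x in torus_measure. norm (g x) \<le> B"
    using torus_cell_subset by (intro AE_I2) (auto intro!: B)
  ultimately show ?thesis
    by (intro finite_measure.integrable_const_bound[OF finite_torus_measure])
qed

text \<open>
  Lebesgue measure on \<open>\<real>\<^sup>n\<close> is the image of a product measure, so integrals of products of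
  functions of the single coordinates factorize.
\<close>
lemma lborel_integral_prod:
  fixes f :: "'n::finite \<Rightarrow> real \<Rightarrow> complex"
  assumes "\<And>i. integrable lborel (f i)"
  shows "(\<integral>x. (\<Prod>i\<in>UNIV. f i (x $ i)) \<partial>(lborel :: (real^'n) measure)) = (\<Prod>i\<in>UNIV. \<integral>t. f i t \<partial>lborel)"
proof -
  interpret product_sigma_finite "\<lambda>b::real^'n. lborel :: real measure"
    by standard
  have [measurable]: "f i \<in> borel_measurable borel" for i using assms[of i] by auto
  have inj: "inj (\<lambda>i::'n. axis i (1::real))" by (auto simp: inj_on_def axis_eq_axis)
  have B: "(Basis :: (real^'n) set) = range (\<lambda>i. axis i 1)" by (auto simp: Basis_vec_def)
  define ix where "ix b = (THE i. b = axis i (1::real))" for b :: "real^'n"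
  have ix: "ix (axis i 1) = i" for i :: 'n
    unfolding ix_def by (rule the_equality) (auto simp: axis_eq_axis)
  have comp: "(\<Sum>b\<in>(Basis :: (real^'n) set). g b *\<^sub>R b) $ i = g (axis i 1)" for g :: "real^'n \<Rightarrow> real" and i
    by (subst cart_eq_inner_axis) (simp add: axis_in_Basis_iff)
  have "(\<integral>x. (\<Prod>i\<in>UNIV. f i (x $ i)) \<partial>(lborel :: (real^'n) measure))
      = (\<integral>g. (\<Prod>i\<in>UNIV. f i (g (axis i 1))) \<partial>(\<Pi>\<^sub>M b\<in>(Basis :: (real^'n) set). lborel))"
    by (subst lborel_eq, subst integral_distr) (auto simp: comp simp del: sum_component)
  also have "\<dots> = (\<integral>g. (\<Prod>b\<in>Basis. f (ix b) (g b)) \<partial>(\<Pi>\<^sub>M b\<in>(Basis :: (real^'n) set). lborel))"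
    by (simp add: B prod.reindex[OF inj] ix)
  also have "\<dots> = (\<Prod>b\<in>(Basis :: (real^'n) set). \<integral>t. f (ix b) t \<partial>lborel)"
    by (rule product_integral_prod) (auto simp: assms)
  also have "\<dots> = (\<Prod>i\<in>UNIV. \<integral>t. f i t \<partial>lborel)"
    by (simp add: B prod.reindex[OF inj] ix)
  finally show ?thesis .
qed

lemma integral_cis_period:
  fixes k :: int
  defines "g \<equiv> \<lambda>t. indicator {-1/2..<1/2} t *\<^sub>R cis (2 * pi * (real_of_int k * t))"
  shows "integrable lborel g" and "(\<integral>t. g t \<partial>lborel) = (if k = 0 then 1 else 0)"
proof -
  let ?h = "\<lambda>t. indicator {-1/2..1/2} t *\<^sub>R cis (2 * pi * (real_of_int k * t))"
  let ?F = "\<lambda>t. if k = 0 then of_real t else cis (2 * pi * (real_of_int k * t)) / (2 * pi * \<i> * of_int k)"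
  \<comment> \<open>The half-open interval is replaced by the compact one, to which the fundamental theorem
     of calculus applies.\<close>
  have AE: "AE t in lborel. ?h t = g t"
    using AE_lborel_singleton[of "1/2"] by eventually_elim (auto simp: g_def indicator_def)
  have cont: "continuous_on {-1/2..1/2} (\<lambda>t. cis (2 * pi * (real_of_int k * t)))"
    by (intro continuous_intros)
  have deriv: "(?F has_vector_derivative cis (2 * pi * (real_of_int k * t))) (at t within {-1/2..1/2})" for t
  proof (cases "k = 0")
    case True
    then show ?thesis by (auto intro!: derivative_eq_intros simp: has_vector_derivative_of_real)
  next
    case False
    have "((\<lambda>z. exp (2 * pi * \<i> * of_int k * z) / (2 * pi * \<i> * of_int k)) has_field_derivative
        exp (2 * pi * \<i> * of_int k * of_real t)) (at (of_real t))"
      using False by (auto intro!: derivative_eq_intros)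
    from has_vector_derivative_real_field[OF this] False show ?thesis
      by (simp add: cis_conv_exp mult_ac)
  qed
  have has: "has_bochner_integral lborel ?h (?F (1/2) - ?F (-1/2))"
    by (rule has_bochner_integral_FTC_Icc[OF _ deriv cont]) auto
  have val: "?F (1/2) - ?F (-1/2) = (if k = 0 then 1 else 0)"
  proof (cases "k = 0")
    case False
    have "cis (2 * pi * (real_of_int k * (1/2))) = cis (2 * pi * (real_of_int k * (-1/2)))"
    proof -
      have "cis (2 * pi * (real_of_int k * (1/2))) = cis (2 * pi * (real_of_int k * (-1/2))) * cis (2 * pi * real_of_int k)"
        by (simp add: cis_mult algebra_simps)
      also have "cis (2 * pi * real_of_int k) = 1"
        by (simp add: cis_multiple_2pi)
      finally show ?thesis by simp
    qed
    with False show ?thesis by simp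
  qed auto
  have [measurable]: "(\<lambda>t. cis (2 * pi * (real_of_int k * t))) \<in> borel_measurable borel"
    by (intro borel_measurable_continuous_onI continuous_intros)
  have m: "g \<in> borel_measurable lborel" "?h \<in> borel_measurable lborel"
    unfolding g_def by simp_all
  show "integrable lborel g"
    using has integrable_cong_AE[OF m(2,1) AE] by (auto simp: has_bochner_integral_iff)
  show "(\<integral>t. g t \<partial>lborel) = (if k = 0 then 1 else 0)"
    using has integral_cong_AE[OF m(2,1) AE] val by (auto simp: has_bochner_integral_iff)
qed

lemma continuous_wave [continuous_intros]: "continuous_on A (wave k)"
  unfolding wave_def freq_dot_def by (intro continuous_intros)

text \<open>
  The indicator of the cell and the exponential both factorize over the coordinates, which
  reduces the orthogonality relations to integrals over one period.
\<close>
lemma torus_integral_wave: "(\<integral>x. wave k x \<partial>torus_measure) = (if k = 0 then 1 else 0)"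
proof -
  let ?g = "\<lambda>i t. indicator {-1/2..<1/2} t *\<^sub>R cis (2 * pi * (real_of_int (k $ i) * t))"
  have "wave k x = (\<Prod>i\<in>UNIV. cis (2 * pi * (real_of_int (k $ i) * x $ i)))" for x
    unfolding wave_def freq_dot_def cis_conv_exp sum_distrib_left of_real_sum by (rule exp_sum) simp
  moreover have "indicator torus_cell x = (\<Prod>i\<in>UNIV. indicator {-1/2..<1/2} (x $ i) :: real)" for x
    by (auto simp: torus_cell_def indicator_def)
  ultimately have prod: "indicator torus_cell x *\<^sub>R wave k x = (\<Prod>i\<in>UNIV. ?g i (x $ i))" for x
    by (simp add: scaleR_conv_of_real prod.distrib)
  have m: "(\<lambda>x. indicator torus_cell x *\<^sub>R wave k x) \<in> borel_measurable borel"
    using torus_cell_borel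
    by (intro borel_measurable_scaleR borel_measurable_indicator borel_measurable_continuous_onI continuous_intros) auto
  have "(\<integral>x. wave k x \<partial>torus_measure) = (\<integral>x. indicator torus_cell x *\<^sub>R wave k x \<partial>lebesgue)"
    by (subst integral_restrict_space) (use torus_cell_borel in auto)
  also have "\<dots> = (\<integral>x. indicator torus_cell x *\<^sub>R wave k x \<partial>lborel)"
    by (rule integral_completion) (use m in simp)
  also have "\<dots> = (\<Prod>i\<in>UNIV. \<integral>t. ?g i t \<partial>lborel)"
    unfolding prod by (rule lborel_integral_prod) (rule integral_cis_period)
  also have "\<dots> = (\<Prod>i\<in>UNIV. if k $ i = 0 then 1 else 0)"
    by (simp only: integral_cis_period)
  also have "\<dots> = (if k = 0 then 1 else 0)"
    by (auto simp: vec_eq_iff)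
  finally show ?thesis .
qed

section \<open>Real trigonometric polynomials\<close>
definition trig_poly :: "nat \<Rightarrow> (int ^ 3 \<Rightarrow> complex) \<Rightarrow> real ^ 3 \<Rightarrow> real" where
  "trig_poly N c x = Re (\<Sum>k\<in>freqs N. c k * wave k x)"

text \<open>
  The symmetry that makes the trigonometric sum real before the real part is taken. It pins
  the coefficients down: without it, different coefficients have the same real part.
\<close>
definition hermitian_coeffs :: "(int ^ 3 \<Rightarrow> complex) \<Rightarrow> bool" where
  "hermitian_coeffs c \<longleftrightarrow> (\<forall>k. c (- k) = cnj (c k))"

text \<open>
  The eigenvalue of \<open>-\<Delta>\<close> on the mode \<open>k\<close>.
\<close>
definition eigenval :: "int ^ 3 \<Rightarrow> real" where
  "eigenval k = 4 * pi\<^sup>2 * (\<Sum>i\<in>UNIV. (real_of_int (k $ i))\<^sup>2)"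

lemma freqs_eq: "freqs N = vec_lambda ` (\<Pi>\<^sub>E i\<in>UNIV. {- int N..int N})"
proof (intro equalityI subsetI)
  fix k :: "int ^ 3" assume "k \<in> freqs N"
  then have "($) k \<in> (\<Pi>\<^sub>E i\<in>UNIV. {- int N..int N})"
    by (auto simp: freqs_def abs_le_iff minus_le_iff)
  then show "k \<in> vec_lambda ` (\<Pi>\<^sub>E i\<in>UNIV. {- int N..int N})"
    by (rule image_eqI[rotated]) simp
next
  fix k :: "int ^ 3" assume "k \<in> vec_lambda ` (\<Pi>\<^sub>E i\<in>UNIV. {- int N..int N})"
  then obtain g where "k = vec_lambda g" and "g \<in> (\<Pi>\<^sub>E i\<in>UNIV. {- int N..int N})" by blast
  then have "k $ i \<in> {- int N..int N}" for i by auto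
  then show "k \<in> freqs N"
    by (simp add: freqs_def abs_le_iff minus_le_iff)
qed

lemma finite_freqs [simp]: "finite (freqs N)"
  unfolding freqs_eq by (intro finite_imageI finite_PiE) auto

lemma card_freqs: "card (freqs N) = (2 * N + 1) ^ 3"
proof -
  have "inj_on vec_lambda (\<Pi>\<^sub>E i\<in>(UNIV :: 3 set). {- int N..int N})"
    by (auto simp: inj_on_def vec_lambda_inject)
  then show ?thesis
    unfolding freqs_eq by (simp add: card_image card_PiE nat_add_distrib nat_mult_distrib)
qed

lemma zero_in_freqs [simp]: "0 \<in> freqs N"
  by (simp add: freqs_def)

lemma minus_in_freqs [simp]: "- k \<in> freqs N \<longleftrightarrow> k \<in> freqs N"
  by (simp add: freqs_def)

lemma sum_freqs_minus: "(\<Sum>k\<in>freqs N. g (- k)) = (\<Sum>k\<in>freqs N. g k)"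
  by (rule sum.reindex_bij_witness[of _ uminus uminus]) auto

lemma wave_minus: "wave (- k) x = cnj (wave k x)"
  by (simp add: wave_def cis_cnj freq_dot_def sum_negf)

lemma wave_add: "wave (k + l) x = wave k x * wave l x"
  by (simp add: wave_def cis_mult freq_dot_def sum.distrib algebra_simps)

lemma norm_wave [simp]: "norm (wave k x) = 1"
  by (simp add: wave_def)

lemma wave_zero [simp]: "wave 0 x = 1"
  by (simp add: wave_def freq_dot_def)

lemma exp_eq_wave: "exp (2 * of_real pi * \<i> * of_real (freq_dot k x)) = wave k x"
  by (simp add: wave_def cis_conv_exp mult_ac)

lemma exp_minus_eq_wave: "exp (- 2 * of_real pi * \<i> * of_real (freq_dot k x)) = cnj (wave k x)"
  by (simp add: wave_def cis_conv_exp mult_ac exp_cnj)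

lemma hermitian_real:
  assumes "hermitian_coeffs c"
  shows "(\<Sum>k\<in>freqs N. c k * wave k x) = of_real (trig_poly N c x)"
proof -
  have "cnj (\<Sum>k\<in>freqs N. c k * wave k x) = (\<Sum>k\<in>freqs N. c (- k) * wave (- k) x)"
    using assms by (simp add: cnj_sum wave_minus hermitian_coeffs_def)
  also have "\<dots> = (\<Sum>k\<in>freqs N. c k * wave k x)"
    by (rule sum_freqs_minus)
  finally show ?thesis
    unfolding trig_poly_def by (metis Reals_cnj_iff of_real_Re)
qed

lemma continuous_trig_poly [continuous_intros]: "continuous_on A (trig_poly N c)"
  unfolding trig_poly_def by (intro continuous_intros)

lemma trig_poly_add: "trig_poly N c x + trig_poly N d x = trig_poly N (\<lambda>k. c k + d k) x"
  by (simp add: trig_poly_def distrib_right sum.distrib)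

lemma trig_poly_diff: "trig_poly N c x - trig_poly N d x = trig_poly N (\<lambda>k. c k - d k) x"
  by (simp add: trig_poly_def left_diff_distrib sum_subtractf)

lemma trig_poly_scale: "r * trig_poly N c x = trig_poly N (\<lambda>k. of_real r * c k) x"
  by (simp add: trig_poly_def sum_distrib_left mult.assoc Re_sum)

lemma abs_trig_poly_le: "\<bar>trig_poly N c x\<bar> \<le> (\<Sum>k\<in>freqs N. norm (c k))"
proof -
  have "\<bar>trig_poly N c x\<bar> \<le> norm (\<Sum>k\<in>freqs N. c k * wave k x)"
    unfolding trig_poly_def by (rule abs_Re_le_cmod)
  also have "\<dots> \<le> (\<Sum>k\<in>freqs N. norm (c k))"
    by (rule sum_norm_le) (simp add: norm_mult)
  finally show ?thesis .
qed

text \<open>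
  \<open>a cos + b sin\<close> is the real part of \<open>(a - \<i>b)\<close> times the exponential; averaging the
  coefficients of \<open>k\<close> and \<open>-k\<close> makes them hermitian without changing the real part.
\<close>
lemma X_space_trig_poly:
  assumes "u \<in> X_space N"
  obtains c where "hermitian_coeffs c" and "u = trig_poly N c"
proof -
  obtain a b where u: "u = (\<lambda>x. \<Sum>k\<in>freqs N. a k * cos (2 * pi * freq_dot k x) + b k * sin (2 * pi * freq_dot k x))"
    using assms unfolding X_space_def by blast
  define h where "h k = Complex (a k) (- b k)" for k
  define c where "c k = (h k + cnj (h (- k))) / 2" for k
  have "u x = trig_poly N c x" for x
  proof -
    have "u x = Re (\<Sum>k\<in>freqs N. h k * wave k x)"
      by (simp add: u h_def wave_def)
    moreover have "Re (\<Sum>k\<in>freqs N. cnj (h (- k)) * wave k x) = Re (\<Sum>k\<in>freqs N. h k * wave k x)"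
    proof -
      have "(\<Sum>k\<in>freqs N. cnj (h (- k)) * wave k x) = (\<Sum>k\<in>freqs N. cnj (h (- k) * wave (- k) x))"
        by (simp add: wave_minus)
      also have "\<dots> = (\<Sum>k\<in>freqs N. cnj (h k * wave k x))"
        by (rule sum_freqs_minus)
      finally show ?thesis by (simp flip: cnj_sum)
    qed
    moreover have "(\<Sum>k\<in>freqs N. c k * wave k x) =
        ((\<Sum>k\<in>freqs N. h k * wave k x) + (\<Sum>k\<in>freqs N. cnj (h (- k)) * wave k x)) / 2"
      by (simp add: c_def sum_divide_distrib distrib_right add_divide_distrib flip: sum.distrib)
    ultimately show ?thesis
      unfolding trig_poly_def by (simp only: Re_divide_numeral plus_complex.sel) simp
  qed
  moreover have "hermitian_coeffs c"
    by (simp add: hermitian_coeffs_def c_def add.commute)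
  ultimately show thesis using that by blast
qed

lemma fourier_coeff_eq: "fourier_coeff u k = (\<integral>x. of_real (u x) * cnj (wave k x) \<partial>torus_measure)"
  unfolding fourier_coeff_def torus_integral_eq exp_minus_eq_wave ..

lemma hermitian_fourier_coeff: "hermitian_coeffs (fourier_coeff u)"
proof -
  have "cnj (\<integral>x. of_real (u x) * cnj (wave k x) \<partial>torus_measure) =
      (\<integral>x. of_real (u x) * wave k x \<partial>torus_measure)" for k
    by (simp flip: Bochner_Integration.integral_cnj)
  then show ?thesis
    by (simp add: hermitian_coeffs_def fourier_coeff_eq wave_minus)
qed

lemma proj_eq_trig_poly: "proj N u = trig_poly N (fourier_coeff u)"
  by (auto simp: proj_def trig_poly_def exp_eq_wave)

lemma integral_mult_trig_poly:
  assumes "continuous_on UNIV g"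
  shows "(\<integral>x. g x * trig_poly N d x \<partial>torus_measure) = (\<Sum>k\<in>freqs N. Re (d k * cnj (fourier_coeff g k)))"
proof -
  have i: "integrable torus_measure (\<lambda>x. complex_of_real (g x) * wave k x)" for k
    by (intro continuous_integrable_torus continuous_intros assms)
  have "(\<integral>x. g x * trig_poly N d x \<partial>torus_measure)
      = (\<integral>x. Re (\<Sum>k\<in>freqs N. d k * (complex_of_real (g x) * wave k x)) \<partial>torus_measure)"
    by (intro Bochner_Integration.integral_cong) (auto simp: trig_poly_def sum_distrib_left algebra_simps)
  also have "\<dots> = Re (\<integral>x. (\<Sum>k\<in>freqs N. d k * (complex_of_real (g x) * wave k x)) \<partial>torus_measure)"
    by (intro integral_Re Bochner_Integration.integrable_sum integrable_mult_right i)
  also have "\<dots> = Re (\<Sum>k\<in>freqs N. d k * (\<integral>x. complex_of_real (g x) * wave k x \<partial>torus_measure))"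
    by (subst Bochner_Integration.integral_sum) (auto intro!: i)
  also have "(\<lambda>k. \<integral>x. complex_of_real (g x) * wave k x \<partial>torus_measure) = (\<lambda>k. cnj (fourier_coeff g k))"
    unfolding fourier_coeff_eq by (simp flip: Bochner_Integration.integral_cnj)
  finally show ?thesis by simp
qed

lemma fourier_coeff_trig_poly:
  assumes "hermitian_coeffs c" "k \<in> freqs N"
  shows "fourier_coeff (trig_poly N c) k = c k"
proof -
  have i: "integrable torus_measure (wave l)" for l
    by (intro continuous_integrable_torus continuous_intros)
  have "fourier_coeff (trig_poly N c) k = (\<integral>x. (\<Sum>l\<in>freqs N. c l * wave (l - k) x) \<partial>torus_measure)"
    unfolding fourier_coeff_eq hermitian_real[OF assms(1), symmetric]
    by (intro Bochner_Integration.integral_cong)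
      (auto simp: sum_distrib_right wave_add wave_minus mult.assoc diff_conv_add_uminus simp del: add_uminus_conv_diff)
  also have "\<dots> = (\<Sum>l\<in>freqs N. c l * (\<integral>x. wave (l - k) x \<partial>torus_measure))"
    by (subst Bochner_Integration.integral_sum) (auto intro!: i)
  also have "\<dots> = (\<Sum>l\<in>freqs N. if l = k then c l else 0)"
    by (intro sum.cong) (auto simp: torus_integral_wave)
  also have "\<dots> = c k"
    using assms(2) by simp
  finally show ?thesis .
qed

lemma parseval:
  assumes "hermitian_coeffs c"
  shows "(\<integral>x. (trig_poly N c x)\<^sup>2 \<partial>torus_measure) = (\<Sum>k\<in>freqs N. (norm (c k))\<^sup>2)"
proof -
  have "(\<integral>x. trig_poly N c x * trig_poly N c x \<partial>torus_measure) = (\<Sum>k\<in>freqs N. Re (c k * cnj (c k)))"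
    by (subst integral_mult_trig_poly)
      (auto intro!: continuous_intros sum.cong simp: fourier_coeff_trig_poly assms)
  then show ?thesis
    by (simp add: power2_eq_square flip: complex_norm_square of_real_power)
qed

lemma trig_poly_eq_zero_iff:
  assumes "hermitian_coeffs c" "\<And>x. trig_poly N c x = 0" "k \<in> freqs N"
  shows "c k = 0"
proof -
  have "trig_poly N c = (\<lambda>x. 0)" using assms(2) by auto
  then show ?thesis
    using fourier_coeff_trig_poly[OF assms(1,3)] by (simp add: fourier_coeff_eq)
qed

text \<open>
  The square of the distance from \<open>g\<close> to its truncated Fourier series is nonnegative.
\<close>
lemma bessel:
  assumes "continuous_on UNIV g"
  shows "(\<Sum>k\<in>freqs N. (norm (fourier_coeff g k))\<^sup>2) \<le> (\<integral>x. (g x)\<^sup>2 \<partial>torus_measure)"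
proof -
  let ?t = "trig_poly N (fourier_coeff g)"
  let ?S = "\<Sum>k\<in>freqs N. (norm (fourier_coeff g k))\<^sup>2"
  have i: "integrable torus_measure (\<lambda>x. (g x)\<^sup>2)" "integrable torus_measure (\<lambda>x. g x * ?t x)"
     "integrable torus_measure (\<lambda>x. (?t x)\<^sup>2)"
    by (intro continuous_integrable_torus continuous_intros assms)+
  have gt: "(\<integral>x. g x * ?t x \<partial>torus_measure) = ?S"
    by (subst integral_mult_trig_poly[OF assms]) (simp flip: complex_norm_square of_real_power)
  have "0 \<le> (\<integral>x. (g x - ?t x)\<^sup>2 \<partial>torus_measure)" by simp
  also have "\<dots> = (\<integral>x. (g x)\<^sup>2 - 2 * (g x * ?t x) + (?t x)\<^sup>2 \<partial>torus_measure)"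
    by (simp add: power2_diff algebra_simps)
  also have "\<dots> = (\<integral>x. (g x)\<^sup>2 \<partial>torus_measure) - 2 * ?S + ?S"
    using i by (simp add: gt parseval[OF hermitian_fourier_coeff])
  finally show ?thesis by simp
qed

lemma partial_deriv_trig_poly:
  "partial_deriv i (trig_poly N c) = trig_poly N (\<lambda>k. 2 * pi * \<i> * of_int (k $ i) * c k)"
proof
  fix x
  have "freq_dot k (t *\<^sub>R axis i 1) = t * of_int (k $ i)" for k t
    by (simp add: freq_dot_def axis_def if_distrib mult_ac cong: if_cong)
  then have fd: "freq_dot k (x + t *\<^sub>R axis i 1) = freq_dot k x + t * of_int (k $ i)" for k t
    by (simp add: freq_dot_def distrib_left sum.distrib)
  have "((\<lambda>t. cis (2 * pi * (freq_dot k x + t * of_int (k $ i)))) has_vector_derivative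
      2 * pi * \<i> * of_int (k $ i) * wave k x) (at 0)" for k
  proof -
    have "((\<lambda>z. exp (2 * pi * \<i> * (of_real (freq_dot k x) + z * of_int (k $ i)))) has_field_derivative
        2 * pi * \<i> * of_int (k $ i) * exp (2 * pi * \<i> * of_real (freq_dot k x))) (at (of_real 0))"
      by (auto intro!: derivative_eq_intros)
    from has_vector_derivative_real_field[OF this] show ?thesis
      by (simp add: wave_def cis_conv_exp mult_ac)
  qed
  then have "((\<lambda>t. \<Sum>k\<in>freqs N. c k * wave k (x + t *\<^sub>R axis i 1)) has_vector_derivative
      (\<Sum>k\<in>freqs N. c k * (2 * pi * \<i> * of_int (k $ i) * wave k x))) (at 0)"
    unfolding wave_def[of _ "_ + _"] fd by (intro has_vector_derivative_sum has_vector_derivative_mult_right)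
  then have "((\<lambda>t. trig_poly N c (x + t *\<^sub>R axis i 1)) has_real_derivative
      Re (\<Sum>k\<in>freqs N. c k * (2 * pi * \<i> * of_int (k $ i) * wave k x))) (at 0)"
    unfolding trig_poly_def has_real_derivative_iff_has_vector_derivative
    by (rule bounded_linear.has_vector_derivative[OF bounded_linear_Re])
  then show "partial_deriv i (trig_poly N c) x = trig_poly N (\<lambda>k. 2 * pi * \<i> * of_int (k $ i) * c k) x"
    unfolding partial_deriv_def by (simp add: DERIV_imp_deriv trig_poly_def mult_ac)
qed

lemma laplacian_trig_poly: "laplacian (trig_poly N c) = trig_poly N (\<lambda>k. - of_real (eigenval k) * c k)"
proof
  fix x
  have "laplacian (trig_poly N c) x =
      Re (\<Sum>k\<in>freqs N. (\<Sum>i\<in>UNIV. 2 * pi * \<i> * of_int (k $ i) * (2 * pi * \<i> * of_int (k $ i) * c k)) * wave k x)"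
    unfolding laplacian_def partial_deriv_trig_poly trig_poly_def Re_sum[symmetric] sum_distrib_right
    by (subst sum.swap) simp
  also have "(\<lambda>k. \<Sum>i\<in>UNIV. 2 * pi * \<i> * of_int (k $ i) * (2 * pi * \<i> * of_int (k $ i) * c k)) =
      (\<lambda>k. - of_real (eigenval k) * c k)"
    by (simp add: eigenval_def sum_distrib_left sum_distrib_right power2_eq_square algebra_simps flip: sum_negf)
  finally show "laplacian (trig_poly N c) x = trig_poly N (\<lambda>k. - of_real (eigenval k) * c k) x"
    unfolding trig_poly_def .
qed

lemma eigenval_nonneg: "0 \<le> eigenval k"
  by (simp add: eigenval_def sum_nonneg)

lemma eigenval_pos:
  assumes "k \<noteq> 0"
  shows "0 < eigenval k"
proof -
  obtain i where "k $ i \<noteq> 0" using assms by (auto simp: vec_eq_iff)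
  then have "0 < (\<Sum>i\<in>UNIV. (real_of_int (k $ i))\<^sup>2)"
    by (intro sum_pos2[of _ i]) auto
  then show ?thesis by (simp add: eigenval_def)
qed

lemma eigenval_zero [simp]: "eigenval 0 = 0"
  by (simp add: eigenval_def)

lemma eigenval_minus [simp]: "eigenval (- k) = eigenval k"
  by (simp add: eigenval_def)

lemma integral_grad_squared:
  assumes "hermitian_coeffs c"
  shows "(\<integral>x. (norm (grad (trig_poly N c) x))\<^sup>2 \<partial>torus_measure) = (\<Sum>k\<in>freqs N. eigenval k * (norm (c k))\<^sup>2)"
proof -
  let ?d = "\<lambda>i k. 2 * pi * \<i> * of_int (k $ i) * c k"
  have h: "hermitian_coeffs (?d i)" for i
    using assms by (simp add: hermitian_coeffs_def)
  have "(\<integral>x. (norm (grad (trig_poly N c) x))\<^sup>2 \<partial>torus_measure)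
      = (\<integral>x. (\<Sum>i\<in>UNIV. (trig_poly N (?d i) x)\<^sup>2) \<partial>torus_measure)"
    by (simp add: grad_def norm_vec_def L2_set_def sum_nonneg partial_deriv_trig_poly)
  also have "\<dots> = (\<Sum>i\<in>UNIV. \<integral>x. (trig_poly N (?d i) x)\<^sup>2 \<partial>torus_measure)"
    by (intro Bochner_Integration.integral_sum continuous_integrable_torus continuous_intros)
  also have "\<dots> = (\<Sum>i\<in>UNIV. \<Sum>k\<in>freqs N. (norm (?d i k))\<^sup>2)"
    by (simp only: parseval[OF h])
  also have "\<dots> = (\<Sum>k\<in>freqs N. eigenval k * (norm (c k))\<^sup>2)"
    by (subst sum.swap)
      (simp add: eigenval_def sum_distrib_left sum_distrib_right norm_mult power_mult_distrib mult_ac)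
  finally show ?thesis .
qed

lemma energy_nonneg: "0 < \<nu> \<Longrightarrow> 0 \<le> energy \<nu> u"
  unfolding energy_def torus_integral_eq by (rule Bochner_Integration.integral_nonneg) simp

lemma energy_trig_poly:
  assumes "hermitian_coeffs c"
  shows "energy \<nu> (trig_poly N c) = \<nu> / 2 * (\<Sum>k\<in>freqs N. eigenval k * (norm (c k))\<^sup>2)
    + (\<integral>x. 1/4 * ((trig_poly N c x)\<^sup>2 - 1)\<^sup>2 \<partial>torus_measure)"
proof -
  have "continuous_on UNIV (grad (trig_poly N c))"
    unfolding grad_def partial_deriv_trig_poly by (intro continuous_intros)
  then have "integrable torus_measure (\<lambda>x. (norm (grad (trig_poly N c) x))\<^sup>2)"
    by (intro continuous_integrable_torus continuous_intros)
  moreover have "integrable torus_measure (\<lambda>x. 1/4 * ((trig_poly N c x)\<^sup>2 - 1)\<^sup>2)"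
    by (intro continuous_integrable_torus continuous_intros)
  ultimately show ?thesis
    unfolding energy_def torus_integral_eq by (simp add: integral_grad_squared[OF assms])
qed

section \<open>Lattice sums\<close>

text \<open>
  The sum is compared with the integral of \<open>1 / (1 + t\<^sup>2)\<close>: each term is at most an increment
  of the arc tangent.
\<close>
lemma sum_reciprocal_le:
  fixes a :: real
  assumes "0 < a"
  shows "(\<Sum>n=1..N. 1 / (1 + (a * real n)\<^sup>2)) \<le> 2 / a"
proof -
  have step: "a / (1 + (a * real (Suc n))\<^sup>2) \<le> arctan (a * real (Suc n)) - arctan (a * real n)" for n
  proof -
    have "a * real n < a * real (Suc n)" using assms by simp
    then obtain z where z: "a * real n < z" "z < a * real (Suc n)"
      and eq: "arctan (a * real (Suc n)) - arctan (a * real n) = (a * real (Suc n) - a * real n) * inverse (1 + z\<^sup>2)"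
      using MVT2[of "a * real n" "a * real (Suc n)" arctan "\<lambda>z. inverse (1 + z\<^sup>2)"] DERIV_arctan by blast
    have "0 \<le> a * real n" using assms by simp
    with z have "z\<^sup>2 \<le> (a * real (Suc n))\<^sup>2" by (intro power_mono) auto
    then have "a * inverse (1 + (a * real (Suc n))\<^sup>2) \<le> a * inverse (1 + z\<^sup>2)"
      using assms by (intro mult_left_mono le_imp_inverse_le) (auto intro: add_pos_nonneg)
    then show ?thesis unfolding eq by (simp add: algebra_simps divide_inverse)
  qed
  have "(\<Sum>n=1..N. a / (1 + (a * real n)\<^sup>2)) \<le> arctan (a * real N)"
  proof (induction N)
    case (Suc N)
    then show ?case using step[of N] by simp
  qed simp
  also have "\<dots> \<le> 2" using arctan_ubound[of "a * real N"] pi_less_4 by simp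
  finally have "a * (\<Sum>n=1..N. 1 / (1 + (a * real n)\<^sup>2)) \<le> 2"
    by (simp add: sum_distrib_left)
  then show ?thesis using assms by (simp add: field_simps)
qed

lemma freqs_mono: "freqs n \<subseteq> freqs (Suc n)"
  unfolding freqs_def by (auto intro: order_trans)

text \<open>
  The shell \<open>|k|\<^sub>\<infinity> = n + 1\<close> has \<open>(2n + 3)\<^sup>3 - (2n + 1)\<^sup>3 = 24 (n + 1)\<^sup>2 + 2\<close> points.
\<close>
lemma card_shell: "real (card (freqs (Suc n) - freqs n)) \<le> 26 * (real (Suc n))\<^sup>2"
proof -
  have "real (card (freqs (Suc n) - freqs n)) = real (card (freqs (Suc n))) - real (card (freqs n))"
    using card_Diff_subset[OF finite_freqs freqs_mono] card_mono[OF finite_freqs freqs_mono, of n] by simp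
  also have "\<dots> = (2 * real n + 3) ^ 3 - (2 * real n + 1) ^ 3"
    by (simp add: card_freqs algebra_simps)
  also have "\<dots> \<le> 26 * (real (Suc n))\<^sup>2"
    by (simp add: power3_eq_cube power2_eq_square algebra_simps)
  finally show ?thesis .
qed

lemma eigenval_shell:
  assumes "k \<in> freqs (Suc n) - freqs n"
  shows "(real (Suc n))\<^sup>2 \<le> eigenval k"
proof -
  obtain i where "int n < \<bar>k $ i\<bar>"
    using assms by (auto simp: freqs_def not_le)
  then have "real (Suc n) \<le> \<bar>real_of_int (k $ i)\<bar>" by linarith
  then have "(real (Suc n))\<^sup>2 \<le> \<bar>real_of_int (k $ i)\<bar>\<^sup>2" by (rule power_mono) simp
  also have "\<dots> \<le> (\<Sum>i\<in>UNIV. (real_of_int (k $ i))\<^sup>2)"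
    using member_le_sum[of i UNIV "\<lambda>i. (real_of_int (k $ i))\<^sup>2"] by simp
  also have "\<dots> \<le> eigenval k"
  proof -
    have "1 \<le> pi\<^sup>2" using pi_ge_two by (intro one_le_power) linarith
    then have "1 * (\<Sum>i\<in>UNIV. (real_of_int (k $ i))\<^sup>2) \<le> (4 * pi\<^sup>2) * (\<Sum>i\<in>UNIV. (real_of_int (k $ i))\<^sup>2)"
      by (intro mult_right_mono) (auto intro: sum_nonneg)
    then show ?thesis by (simp add: eigenval_def)
  qed
  finally show ?thesis .
qed

text \<open>
  Lattice sums are reduced to sums over \<open>n = |k|\<^sub>\<infinity>\<close>. A summand is estimated on
  a shell through the lower bound \<open>n\<^sup>2 \<le> \<lambda>\<close> of the eigenvalue there.
\<close>
lemma sum_over_shells: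
  fixes g :: "int ^ 3 \<Rightarrow> real"
  assumes "\<And>n k. 1 \<le> n \<Longrightarrow> (real n)\<^sup>2 \<le> eigenval k \<Longrightarrow> g k \<le> G n"
    and "\<And>n. 0 \<le> G n"
  shows "(\<Sum>k\<in>freqs N - {0}. g k) \<le> (\<Sum>n=1..N. 26 * (real n)\<^sup>2 * G n)"
proof (induction N)
  case 0
  have "freqs 0 - {0} = {}" by (auto simp: freqs_def vec_eq_iff)
  show ?case unfolding \<open>freqs 0 - {0} = {}\<close> by simp
next
  case (Suc N)
  let ?S = "freqs (Suc N) - freqs N"
  have "(\<Sum>k\<in>?S. g k) \<le> real (card ?S) * G (Suc N)"
    using assms(1)[of "Suc N"] eigenval_shell[of _ N] by (intro sum_bounded_above) auto
  also have "\<dots> \<le> 26 * (real (Suc N))\<^sup>2 * G (Suc N)"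
    by (intro mult_right_mono card_shell assms)
  finally have shell: "(\<Sum>k\<in>?S. g k) \<le> 26 * (real (Suc N))\<^sup>2 * G (Suc N)" .
  have split: "freqs (Suc N) - {0} = (freqs N - {0}) \<union> ?S"
    using freqs_mono[of N] by auto
  have "(\<Sum>k\<in>freqs (Suc N) - {0}. g k) = (\<Sum>k\<in>freqs N - {0}. g k) + (\<Sum>k\<in>?S. g k)"
    unfolding split by (rule sum.union_disjoint) auto
  with Suc shell show ?case by simp
qed

lemma quartic_le_quadratic: "1 / (1 + y ^ 4) \<le> 2 / (1 + y\<^sup>2)" "y\<^sup>2 / (1 + y ^ 4) \<le> 2 / (1 + y\<^sup>2)" for y :: real
proof -
  have y4: "y ^ 4 = (y\<^sup>2)\<^sup>2" by simp
  have "2 * y\<^sup>2 \<le> 1 + (y\<^sup>2)\<^sup>2" using sum_squares_bound[of 1 "y\<^sup>2"] by simp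
  then have "1 + y\<^sup>2 \<le> 2 * (1 + y ^ 4)" "y\<^sup>2 * (1 + y\<^sup>2) \<le> 2 * (1 + y ^ 4)"
    unfolding y4 by (simp_all add: power2_eq_square algebra_simps) (use zero_le_square[of "y * y"] in linarith)+
  moreover have "0 < 1 + y ^ 4" "0 < 1 + y\<^sup>2" by (auto intro: add_pos_nonneg)
  ultimately show "1 / (1 + y ^ 4) \<le> 2 / (1 + y\<^sup>2)" "y\<^sup>2 / (1 + y ^ 4) \<le> 2 / (1 + y\<^sup>2)"
    by (simp_all add: divide_le_eq le_divide_eq)
qed

text \<open>
  The factor that turns the \<open>H\<^sup>1\<close> seminorm into the \<open>\<ell>\<^sup>1\<close> norm of the smoothed coefficients.
  In dimension three \<open>n\<^sup>2\<close> lattice points cancel the decay \<open>1/\<lambda>\<close>, so the sum counts the \<open>1/a\<close> shells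
  that are not damped.
\<close>
lemma lattice_sum_gradient:
  assumes "0 < a"
  shows "(\<Sum>k\<in>freqs N - {0}. 1 / (eigenval k * (1 + a ^ 4 * (eigenval k)\<^sup>2)\<^sup>2)) \<le> 104 / a"
proof -
  have "(\<Sum>k\<in>freqs N - {0}. 1 / (eigenval k * (1 + a ^ 4 * (eigenval k)\<^sup>2)\<^sup>2))
      \<le> (\<Sum>n=1..N. 26 * (real n)\<^sup>2 * (1 / ((real n)\<^sup>2 * (1 + (a * real n) ^ 4))))"
  proof (rule sum_over_shells)
    fix n :: nat and k :: "int ^ 3"
    assume n: "1 \<le> n" "(real n)\<^sup>2 \<le> eigenval k"
    have "((real n)\<^sup>2)\<^sup>2 \<le> (eigenval k)\<^sup>2" using n by (intro power_mono) auto
    then have "(a * real n) ^ 4 \<le> a ^ 4 * (eigenval k)\<^sup>2"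
      by (simp add: power_mult_distrib mult_left_mono)
    moreover have "x \<le> (x::real)\<^sup>2" if "1 \<le> x" for x using that by (simp add: power2_eq_square)
    moreover have "0 \<le> a ^ 4 * (eigenval k)\<^sup>2" using assms by simp
    ultimately have "1 + (a * real n) ^ 4 \<le> (1 + a ^ 4 * (eigenval k)\<^sup>2)\<^sup>2" by (smt (verit))
    moreover have "0 < (real n)\<^sup>2" "0 < 1 + (a * real n) ^ 4" using n by (auto intro: add_pos_nonneg)
    ultimately show "1 / (eigenval k * (1 + a ^ 4 * (eigenval k)\<^sup>2)\<^sup>2) \<le> 1 / ((real n)\<^sup>2 * (1 + (a * real n) ^ 4))"
      using n by (intro divide_left_mono mult_mono mult_pos_pos) linarith+
  qed auto
  also have "\<dots> = (\<Sum>n=1..N. 26 * (1 / (1 + (a * real n) ^ 4)))"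
    by (intro sum.cong) auto
  also have "\<dots> \<le> (\<Sum>n=1..N. 26 * (2 / (1 + (a * real n)\<^sup>2)))"
    by (intro sum_mono mult_left_mono quartic_le_quadratic) auto
  also have "\<dots> = 52 * (\<Sum>n=1..N. 1 / (1 + (a * real n)\<^sup>2))"
    by (simp add: sum_distrib_left)
  also have "\<dots> \<le> 52 * (2 / a)"
    by (intro mult_left_mono sum_reciprocal_le assms) auto
  finally show ?thesis by simp
qed

text \<open>
  The corresponding factor for a source term \<open>\<Delta>g\<close> with square integrable \<open>g\<close>. Undamped shells
  contribute \<open>n\<^sup>2 \<lambda>\<^sup>2 = n\<^sup>6\<close> up to \<open>n = 1/a\<close>, hence the power \<open>a\<^sup>-\<^sup>7\<close>.
\<close>
lemma lattice_sum_laplacian: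
  assumes "0 < a"
  shows "(\<Sum>k\<in>freqs N - {0}. (eigenval k / (1 + a ^ 4 * (eigenval k)\<^sup>2))\<^sup>2) \<le> 104 / a ^ 7"
proof -
  have "(\<Sum>k\<in>freqs N - {0}. (eigenval k / (1 + a ^ 4 * (eigenval k)\<^sup>2))\<^sup>2)
      \<le> (\<Sum>n=1..N. 26 * (real n)\<^sup>2 * (1 / (a ^ 4 * (1 + (a * real n) ^ 4))))"
  proof (rule sum_over_shells)
    fix n :: nat and k :: "int ^ 3"
    assume n: "1 \<le> n" "(real n)\<^sup>2 \<le> eigenval k"
    let ?y = "a ^ 4 * (eigenval k)\<^sup>2"
    have "((real n)\<^sup>2)\<^sup>2 \<le> (eigenval k)\<^sup>2" using n by (intro power_mono) auto
    then have le: "(a * real n) ^ 4 \<le> ?y"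
      by (simp add: power_mult_distrib mult_left_mono)
    have y: "0 \<le> ?y" using assms by simp
    have "(eigenval k / (1 + ?y))\<^sup>2 = (?y / (1 + ?y)) * (1 / (a ^ 4 * (1 + ?y)))"
      using assms by (simp add: power2_eq_square)
    also have "\<dots> \<le> 1 * (1 / (a ^ 4 * (1 + ?y)))"
      using y assms by (intro mult_right_mono) (auto simp: divide_le_eq add_pos_nonneg not_less)
    also have "\<dots> \<le> 1 / (a ^ 4 * (1 + (a * real n) ^ 4))"
      unfolding mult_1
      using y assms le by (intro divide_left_mono mult_left_mono mult_pos_pos) (auto simp: add_pos_nonneg)
    finally show "(eigenval k / (1 + ?y))\<^sup>2 \<le> 1 / (a ^ 4 * (1 + (a * real n) ^ 4))" .
  qed (use assms in auto)
  also have "\<dots> = (\<Sum>n=1..N. 26 / a ^ 6 * ((a * real n)\<^sup>2 / (1 + (a * real n) ^ 4)))"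
    using assms by (intro sum.cong refl) (simp add: power_mult_distrib eval_nat_numeral)
  also have "\<dots> \<le> (\<Sum>n=1..N. 26 / a ^ 6 * (2 / (1 + (a * real n)\<^sup>2)))"
    using assms by (intro sum_mono mult_left_mono quartic_le_quadratic) auto
  also have "\<dots> = 52 / a ^ 6 * (\<Sum>n=1..N. 1 / (1 + (a * real n)\<^sup>2))"
    by (simp add: sum_distrib_left)
  also have "\<dots> \<le> 52 / a ^ 6 * (2 / a)"
    using assms by (intro mult_left_mono sum_reciprocal_le assms) auto
  finally show ?thesis by (simp add: eval_nat_numeral)
qed

section \<open>Energy dissipation in one step\<close>

text \<open>
  The potential \<open>(s\<^sup>2 - 1)\<^sup>2 / 4\<close> has derivative \<open>s\<^sup>3 - s\<close>. The exact quadratic remainder is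
  \<open>(t - s)\<^sup>2 (3/4 s\<^sup>2 + 1/2 s t + 1/4 t\<^sup>2 - 1/2)\<close>, and \<open>s t\<close> is absorbed by the squares.
\<close>
lemma potential_taylor:
  fixes s t M :: real
  assumes "s\<^sup>2 \<le> M" "t\<^sup>2 \<le> M"
  shows "1/4 * (t\<^sup>2 - 1)\<^sup>2 \<le> 1/4 * (s\<^sup>2 - 1)\<^sup>2 + nonlin s * (t - s) + 3/2 * M * (t - s)\<^sup>2"
proof -
  have "1/4 * (t\<^sup>2 - 1)\<^sup>2 - 1/4 * (s\<^sup>2 - 1)\<^sup>2 - nonlin s * (t - s) =
      (t - s)\<^sup>2 * (s\<^sup>2 + 1/2 * t\<^sup>2 - 1/2 - 1/4 * (t - s)\<^sup>2)"
    unfolding nonlin_def by algebra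
  also have "\<dots> \<le> (t - s)\<^sup>2 * (3/2 * M)"
    using assms zero_le_power2[of "t - s"] by (intro mult_left_mono; linarith)
  finally show ?thesis by (simp add: algebra_simps)
qed

text \<open>
  The scheme allows \<open>\<delta>\<close> times the nonlinearity to be replaced by \<open>-|\<delta>|\<^sup>2 / (\<tau>\<lambda>)\<close> and
  \<open>-\<nu>\<lambda> \<delta> u\<^sup>n\<^sup>+\<^sup>1\<close>; the latter combines with the change of the gradient energy to \<open>-\<nu>/2 \<lambda> |\<delta>|\<^sup>2\<close>.
  What remains is a quadratic form in \<open>\<delta>\<close> which the hypothesis on \<open>M\<close> makes nonpositive mode by mode.
  The bounds are stated almost everywhere because the one for the initial datum comes from an
  essential supremum.
\<close>
lemma energy_step:
  fixes c c' :: "int ^ 3 \<Rightarrow> complex" and N :: nat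
  defines "g \<equiv> fourier_coeff (\<lambda>x. nonlin (trig_poly N c x))"
  assumes \<nu>: "0 < \<nu>" and \<tau>: "0 < \<tau>" and h: "hermitian_coeffs c" "hermitian_coeffs c'"
    and step: "\<And>k. k \<in> freqs N \<Longrightarrow>
      c' k - c k = - of_real (\<tau> * eigenval k) * (of_real (\<nu> * eigenval k) * c' k + g k)"
    and M: "3/2 * M \<le> sqrt (2 * \<nu> / \<tau>)"
    and bound: "AE x in torus_measure. (trig_poly N c x)\<^sup>2 \<le> M" "AE x in torus_measure. (trig_poly N c' x)\<^sup>2 \<le> M"
  shows "energy \<nu> (trig_poly N c') \<le> energy \<nu> (trig_poly N c)"
proof -
  let ?u = "trig_poly N c" and ?v = "trig_poly N c'"
  define d where "d k = c' k - c k" for k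
  have hd: "hermitian_coeffs d" using h by (simp add: hermitian_coeffs_def d_def)
  have diff: "?v x - ?u x = trig_poly N d x" for x
    by (simp add: trig_poly_diff d_def[abs_def])
  have cont: "continuous_on UNIV (\<lambda>x. nonlin (?u x))"
    unfolding nonlin_def by (intro continuous_intros)
  have i1: "integrable torus_measure (\<lambda>x. 1/4 * ((?v x)\<^sup>2 - 1)\<^sup>2)"
    and i2: "integrable torus_measure (\<lambda>x. 1/4 * ((?u x)\<^sup>2 - 1)\<^sup>2)"
    and i3: "integrable torus_measure (\<lambda>x. nonlin (?u x) * trig_poly N d x)"
    and i4: "integrable torus_measure (\<lambda>x. 3/2 * M * (trig_poly N d x)\<^sup>2)"
    by (intro continuous_integrable_torus continuous_intros cont)+
  have "(\<integral>x. 1/4 * ((?v x)\<^sup>2 - 1)\<^sup>2 \<partial>torus_measure) \<le>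
      (\<integral>x. 1/4 * ((?u x)\<^sup>2 - 1)\<^sup>2 + nonlin (?u x) * trig_poly N d x + 3/2 * M * (trig_poly N d x)\<^sup>2 \<partial>torus_measure)"
  proof (rule integral_mono_AE[OF i1])
    show "AE x in torus_measure. 1/4 * ((?v x)\<^sup>2 - 1)\<^sup>2 \<le>
        1/4 * ((?u x)\<^sup>2 - 1)\<^sup>2 + nonlin (?u x) * trig_poly N d x + 3/2 * M * (trig_poly N d x)\<^sup>2"
      using bound by eventually_elim (unfold diff[symmetric], rule potential_taylor)
  qed (intro Bochner_Integration.integrable_add i2 i3 i4)
  also have "\<dots> = (\<integral>x. 1/4 * ((?u x)\<^sup>2 - 1)\<^sup>2 \<partial>torus_measure)
      + (\<integral>x. nonlin (?u x) * trig_poly N d x \<partial>torus_measure)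
      + (\<integral>x. 3/2 * M * (trig_poly N d x)\<^sup>2 \<partial>torus_measure)"
    using i2 i3 i4 by (simp only: Bochner_Integration.integral_add Bochner_Integration.integrable_add)
  also have "(\<integral>x. nonlin (?u x) * trig_poly N d x \<partial>torus_measure) = (\<Sum>k\<in>freqs N. Re (d k * cnj (g k)))"
    unfolding g_def by (rule integral_mult_trig_poly[OF cont])
  also have "(\<integral>x. 3/2 * M * (trig_poly N d x)\<^sup>2 \<partial>torus_measure) = (\<Sum>k\<in>freqs N. 3/2 * M * (norm (d k))\<^sup>2)"
    by (simp only: integral_mult_right_zero parseval[OF hd] sum_distrib_left)
  finally have pot: "(\<integral>x. 1/4 * ((?v x)\<^sup>2 - 1)\<^sup>2 \<partial>torus_measure) \<le>
      (\<integral>x. 1/4 * ((?u x)\<^sup>2 - 1)\<^sup>2 \<partial>torus_measure) +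
      (\<Sum>k\<in>freqs N. Re (d k * cnj (g k)) + 3/2 * M * (norm (d k))\<^sup>2)"
    by (simp add: sum.distrib)
  have mode: "\<nu> / 2 * (eigenval k * (norm (c' k))\<^sup>2) - \<nu> / 2 * (eigenval k * (norm (c k))\<^sup>2)
      + (Re (d k * cnj (g k)) + 3/2 * M * (norm (d k))\<^sup>2) \<le> 0" if k: "k \<in> freqs N" for k
  proof (cases "k = 0")
    case True
    then have "c' k = c k" using step[OF k] by simp
    then show ?thesis by (simp add: d_def)
  next
    case False
    let ?l = "eigenval k"
    have l: "0 < ?l" using False by (rule eigenval_pos)
    have g: "g k = - (d k / of_real (\<tau> * ?l)) - of_real (\<nu> * ?l) * c' k"
      using step[OF k] l \<tau> by (simp add: d_def field_simps)
    have inner: "Re (d k * cnj (g k)) = - ((norm (d k))\<^sup>2 / (\<tau> * ?l)) - \<nu> * ?l * Re (d k * cnj (c' k))"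
    proof -
      have "d k * cnj (g k) = - (d k * cnj (d k) / of_real (\<tau> * ?l)) - of_real (\<nu> * ?l) * (d k * cnj (c' k))"
        unfolding g by (simp add: algebra_simps)
      moreover have "d k * cnj (d k) / of_real (\<tau> * ?l) = of_real ((norm (d k))\<^sup>2 / (\<tau> * ?l))"
        by (simp only: complex_norm_square[symmetric] of_real_divide)
      moreover have "Re (- of_real p - of_real r * z) = - p - r * Re z" for p r z
        by simp
      ultimately show ?thesis by (simp only:)
    qed
    have polar: "(norm (c k))\<^sup>2 = (norm (c' k))\<^sup>2 - 2 * Re (d k * cnj (c' k)) + (norm (d k))\<^sup>2"
    proof -
      have c': "c' k = c k + d k" by (simp add: d_def)
      show ?thesis unfolding c' cmod_power2 by (simp add: power2_eq_square algebra_simps)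
    qed
    have "\<nu> / 2 * (?l * (norm (c' k))\<^sup>2) - \<nu> / 2 * (?l * (norm (c k))\<^sup>2)
      + (Re (d k * cnj (g k)) + 3/2 * M * (norm (d k))\<^sup>2)
      = (3/2 * M - (\<nu> / 2 * ?l + 1 / (\<tau> * ?l))) * (norm (d k))\<^sup>2"
      unfolding inner polar by (simp add: algebra_simps)
    also have "\<dots> \<le> 0"
    proof (rule mult_nonpos_nonneg)
      have "sqrt (2 * \<nu> / \<tau>) = 2 * sqrt ((\<nu> / 2 * ?l) * (1 / (\<tau> * ?l)))"
        using l \<nu> \<tau> by (simp add: real_sqrt_mult real_sqrt_divide field_simps)
      also have "\<dots> \<le> \<nu> / 2 * ?l + 1 / (\<tau> * ?l)"
        using arith_geo_mean_sqrt[of "\<nu> / 2 * ?l" "1 / (\<tau> * ?l)"] l \<nu> \<tau> by simp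
      finally show "3/2 * M - (\<nu> / 2 * ?l + 1 / (\<tau> * ?l)) \<le> 0" using M by simp
    qed simp
    finally show ?thesis .
  qed
  have "(\<Sum>k\<in>freqs N. \<nu> / 2 * (eigenval k * (norm (c' k))\<^sup>2) - \<nu> / 2 * (eigenval k * (norm (c k))\<^sup>2)
      + (Re (d k * cnj (g k)) + 3/2 * M * (norm (d k))\<^sup>2)) \<le> 0"
    by (rule sum_nonpos) (rule mode)
  then have "\<nu> / 2 * (\<Sum>k\<in>freqs N. eigenval k * (norm (c' k))\<^sup>2)
      - \<nu> / 2 * (\<Sum>k\<in>freqs N. eigenval k * (norm (c k))\<^sup>2)
      + (\<Sum>k\<in>freqs N. Re (d k * cnj (g k)) + 3/2 * M * (norm (d k))\<^sup>2) \<le> 0"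
    by (simp only: sum.distrib sum_subtractf sum_distrib_left)
  with pot show ?thesis
    unfolding energy_trig_poly[OF h(1)] energy_trig_poly[OF h(2)] by linarith
qed

section \<open>The supremum bound for one step\<close>

text \<open>
  One implicit step in Fourier space: the old iterate enters through its \<open>H\<^sup>1\<close> seminorm, the
  nonlinearity through its \<open>L\<^sup>2\<close> norm. The seminorm does not see the zero
  mode, which is why the old iterate must have zero mean.
\<close>
lemma step_norm_bound:
  fixes c c' g :: "int ^ 3 \<Rightarrow> complex"
  assumes a: "0 < a" and \<tau>: "0 < \<tau>"
    and c0: "c 0 = 0"
    and step: "\<And>k. k \<in> freqs N \<Longrightarrow>
      of_real (1 + a ^ 4 * (eigenval k)\<^sup>2) * c' k = c k - of_real (\<tau> * eigenval k) * g k"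
    and A: "(\<Sum>k\<in>freqs N. eigenval k * (norm (c k))\<^sup>2) \<le> A"
    and B: "(\<Sum>k\<in>freqs N. (norm (g k))\<^sup>2) \<le> B"
  shows "(\<Sum>k\<in>freqs N. norm (c' k))\<^sup>2 \<le> 208 * A / a + 208 * \<tau>\<^sup>2 * B / a ^ 7"
proof -
  let ?F = "freqs N - {0}"
  let ?D = "\<lambda>k. 1 + a ^ 4 * (eigenval k)\<^sup>2"
  define S where "S = (\<Sum>k\<in>?F. sqrt (eigenval k) * norm (c k) * (1 / (sqrt (eigenval k) * ?D k)))"
  define T where "T = (\<Sum>k\<in>?F. norm (g k) * (eigenval k / ?D k))"
  have D: "0 < ?D k" for k using a by (auto intro: add_pos_nonneg)
  have c'0: "c' 0 = 0" using step[of 0] c0 by simp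
  \<comment> \<open>The weight \<open>sqrt \<lambda>\<close> is inserted so that Cauchy-Schwarz produces the \<open>H\<^sup>1\<close> seminorm.\<close>
  have each: "norm (c' k) \<le> sqrt (eigenval k) * norm (c k) * (1 / (sqrt (eigenval k) * ?D k))
      + \<tau> * (norm (g k) * (eigenval k / ?D k))" if "k \<in> ?F" for k
  proof -
    have "?D k * norm (c' k) = norm (of_real (?D k) * c' k)"
      using D[of k] by (simp only: norm_mult norm_of_real abs_of_pos)
    also have "\<dots> = norm (c k - of_real (\<tau> * eigenval k) * g k)"
      using step[of k] that by simp
    also have "\<dots> \<le> norm (c k) + norm (of_real (\<tau> * eigenval k) * g k)"
      by (rule norm_triangle_ineq4)
    also have "norm (of_real (\<tau> * eigenval k) * g k) = \<tau> * eigenval k * norm (g k)"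
      using \<tau> eigenval_nonneg[of k] by (simp only: norm_mult norm_of_real) simp
    finally have "norm (c' k) \<le> (norm (c k) + \<tau> * eigenval k * norm (g k)) / ?D k"
      using D[of k] by (simp add: le_divide_eq mult.commute)
    also have "\<dots> = sqrt (eigenval k) * norm (c k) * (1 / (sqrt (eigenval k) * ?D k))
      + \<tau> * (norm (g k) * (eigenval k / ?D k))"
      using eigenval_pos[of k] that by (simp add: add_divide_distrib)
    finally show ?thesis .
  qed
  have "(\<Sum>k\<in>freqs N. norm (c' k)) = (\<Sum>k\<in>?F. norm (c' k))"
    by (rule sum.mono_neutral_right) (auto simp: c'0)
  also have "\<dots> \<le> S + \<tau> * T"
    unfolding S_def T_def sum_distrib_left sum.distrib[symmetric] by (rule sum_mono) (rule each)
  finally have le: "(\<Sum>k\<in>freqs N. norm (c' k)) \<le> S + \<tau> * T" .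
  have A': "(\<Sum>k\<in>?F. eigenval k * (norm (c k))\<^sup>2) \<le> A"
    using A by (simp add: sum_diff1)
  have "(\<Sum>k\<in>?F. (norm (g k))\<^sup>2) \<le> (\<Sum>k\<in>freqs N. (norm (g k))\<^sup>2)"
    by (rule sum_mono2) auto
  with B have B': "(\<Sum>k\<in>?F. (norm (g k))\<^sup>2) \<le> B" by simp
  have "S\<^sup>2 \<le> (\<Sum>k\<in>?F. (sqrt (eigenval k) * norm (c k))\<^sup>2) * (\<Sum>k\<in>?F. (1 / (sqrt (eigenval k) * ?D k))\<^sup>2)"
    unfolding S_def by (rule Cauchy_Schwarz_ineq_sum)
  also have "\<dots> = (\<Sum>k\<in>?F. eigenval k * (norm (c k))\<^sup>2) * (\<Sum>k\<in>?F. 1 / (eigenval k * (?D k)\<^sup>2))"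
    by (simp add: power_mult_distrib power_divide eigenval_nonneg)
  also have "\<dots> \<le> A * (104 / a)"
    using A' by (intro mult_mono lattice_sum_gradient a sum_nonneg order_trans[OF sum_nonneg A'])
      (auto simp: eigenval_nonneg)
  finally have S2: "S\<^sup>2 \<le> A * (104 / a)" .
  have "T\<^sup>2 \<le> (\<Sum>k\<in>?F. (norm (g k))\<^sup>2) * (\<Sum>k\<in>?F. (eigenval k / ?D k)\<^sup>2)"
    unfolding T_def by (rule Cauchy_Schwarz_ineq_sum)
  also have "\<dots> \<le> B * (104 / a ^ 7)"
    using B' by (intro mult_mono lattice_sum_laplacian a sum_nonneg order_trans[OF sum_nonneg B'])
      auto
  finally have T2: "T\<^sup>2 \<le> B * (104 / a ^ 7)" .
  have "(\<Sum>k\<in>freqs N. norm (c' k))\<^sup>2 \<le> (S + \<tau> * T)\<^sup>2"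
    using le by (intro power_mono sum_nonneg) auto
  also have "\<dots> \<le> 2 * S\<^sup>2 + 2 * (\<tau> * T)\<^sup>2"
    using sum_squares_bound[of S "\<tau> * T"] by (simp add: power2_sum)
  also have "\<dots> = 2 * S\<^sup>2 + 2 * \<tau>\<^sup>2 * T\<^sup>2"
    by (simp add: power_mult_distrib)
  also have "\<dots> \<le> 2 * (A * (104 / a)) + 2 * \<tau>\<^sup>2 * (B * (104 / a ^ 7))"
    using S2 T2 by (intro add_mono mult_left_mono) auto
  finally show ?thesis by (simp add: algebra_simps)
qed

text \<open>
  The difference of the two sides of the scheme is a trigonometric polynomial with hermitian
  coefficients that vanishes identically, so the scheme holds mode by mode.
\<close>
lemma scheme_coeffs:
  fixes c c' g :: "int ^ 3 \<Rightarrow> complex"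
  assumes \<tau>: "0 < \<tau>" and h: "hermitian_coeffs c" "hermitian_coeffs c'" "hermitian_coeffs g"
    and eq: "\<And>x. (trig_poly N c' x - trig_poly N c x) / \<tau> =
      - \<nu> * laplacian (laplacian (trig_poly N c')) x + laplacian (trig_poly N g) x"
    and k: "k \<in> freqs N"
  shows "c' k - c k = - of_real (\<tau> * eigenval k) * (of_real (\<nu> * eigenval k) * c' k + g k)"
proof -
  define r where "r k = (c' k - c k) - of_real \<tau> * (- of_real \<nu> * (of_real (eigenval k) * of_real (eigenval k) * c' k)
      + (- of_real (eigenval k) * g k))" for k
  have "hermitian_coeffs r"
    using h by (simp add: hermitian_coeffs_def r_def)
  moreover have "trig_poly N r x = 0" for x
  proof -
    have "trig_poly N c' x - trig_poly N c x =
        \<tau> * (- \<nu> * laplacian (laplacian (trig_poly N c')) x + laplacian (trig_poly N g) x)"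
      unfolding eq[symmetric] using \<tau> by simp
    then show ?thesis
      unfolding laplacian_trig_poly trig_poly_scale trig_poly_add trig_poly_diff
      by (simp add: r_def trig_poly_def sum_subtractf sum.distrib algebra_simps)
  qed
  ultimately have "r k = 0" using k by (rule trig_poly_eq_zero_iff)
  then show ?thesis by (simp add: r_def algebra_simps)
qed

lemma energy_parts_le:
  assumes h: "hermitian_coeffs c" and \<nu>: "0 < \<nu>"
  shows "(\<Sum>k\<in>freqs N. eigenval k * (norm (c k))\<^sup>2) \<le> 2 * energy \<nu> (trig_poly N c) / \<nu>"
    and "(\<integral>x. 1/4 * ((trig_poly N c x)\<^sup>2 - 1)\<^sup>2 \<partial>torus_measure) \<le> energy \<nu> (trig_poly N c)"
proof -
  let ?W = "\<integral>x. 1/4 * ((trig_poly N c x)\<^sup>2 - 1)\<^sup>2 \<partial>torus_measure"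
  let ?G = "\<Sum>k\<in>freqs N. eigenval k * (norm (c k))\<^sup>2"
  have E: "energy \<nu> (trig_poly N c) = \<nu> / 2 * ?G + ?W" by (rule energy_trig_poly[OF h])
  have "0 \<le> ?W" by (rule Bochner_Integration.integral_nonneg) simp
  with E have "\<nu> / 2 * ?G \<le> energy \<nu> (trig_poly N c)" by linarith
  with \<nu> show "?G \<le> 2 * energy \<nu> (trig_poly N c) / \<nu>" by (simp add: field_simps)
  have "0 \<le> ?G" by (intro sum_nonneg mult_nonneg_nonneg eigenval_nonneg) simp
  with E \<nu> show "?W \<le> energy \<nu> (trig_poly N c)" by simp
qed

text \<open>
  Since \<open>f(u)\<^sup>2 = u\<^sup>2 (u\<^sup>2 - 1)\<^sup>2\<close>, a supremum bound on \<open>u\<close> and the potential energy control \<open>f(u)\<close>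
  in \<open>L\<^sup>2\<close>.
\<close>
lemma integral_nonlin_squared_le:
  assumes h: "hermitian_coeffs c" and \<nu>: "0 < \<nu>" and M: "0 \<le> M"
    and bound: "AE x in torus_measure. (trig_poly N c x)\<^sup>2 \<le> M"
  shows "(\<integral>x. (nonlin (trig_poly N c x))\<^sup>2 \<partial>torus_measure) \<le> 4 * energy \<nu> (trig_poly N c) * M"
proof -
  let ?u = "trig_poly N c"
  let ?W = "\<integral>x. 1/4 * ((?u x)\<^sup>2 - 1)\<^sup>2 \<partial>torus_measure"
  have "(\<integral>x. (nonlin (?u x))\<^sup>2 \<partial>torus_measure) \<le> (\<integral>x. 4 * M * (1/4 * ((?u x)\<^sup>2 - 1)\<^sup>2) \<partial>torus_measure)"
  proof (rule integral_mono_AE)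
    show "integrable torus_measure (\<lambda>x. (nonlin (?u x))\<^sup>2)"
      unfolding nonlin_def by (intro continuous_integrable_torus continuous_intros)
    show "integrable torus_measure (\<lambda>x. 4 * M * (1/4 * ((?u x)\<^sup>2 - 1)\<^sup>2))"
      by (intro continuous_integrable_torus continuous_intros)
    show "AE x in torus_measure. (nonlin (?u x))\<^sup>2 \<le> 4 * M * (1/4 * ((?u x)\<^sup>2 - 1)\<^sup>2)"
      using bound
    proof eventually_elim
      fix x assume "(?u x)\<^sup>2 \<le> M"
      then have "(?u x)\<^sup>2 * ((?u x)\<^sup>2 - 1)\<^sup>2 \<le> M * ((?u x)\<^sup>2 - 1)\<^sup>2"
        by (rule mult_right_mono) simp
      moreover have "(nonlin (?u x))\<^sup>2 = (?u x)\<^sup>2 * ((?u x)\<^sup>2 - 1)\<^sup>2"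
        unfolding nonlin_def by algebra
      ultimately show "(nonlin (?u x))\<^sup>2 \<le> 4 * M * (1/4 * ((?u x)\<^sup>2 - 1)\<^sup>2)" by simp
    qed
  qed
  also have "\<dots> = 4 * M * ?W" by (rule integral_mult_right_zero)
  also have "\<dots> \<le> 4 * M * energy \<nu> ?u" using energy_parts_le(2)[OF h \<nu>] M by (intro mult_left_mono) auto
  finally show "(\<integral>x. (nonlin (?u x))\<^sup>2 \<partial>torus_measure) \<le> 4 * energy \<nu> ?u * M" by (simp add: mult_ac)
qed

text \<open>
  The bound \<open>u\<^sup>2 \<le> M\<close> reproduces itself. Both terms of step_norm_bound are multiples of \<open>q M\<close>
  with \<open>q = E a / \<nu>\<^sup>2\<close>: the gradient term because \<open>\<nu> / a\<^sup>2 = sqrt (\<nu>/\<tau>)\<close> is comparable to \<open>M\<close>, the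
  nonlinear one because \<open>\<tau>\<^sup>2 / a\<^sup>7 = a / \<nu>\<^sup>2\<close>. The constant 2000 is any number above
  \<open>416 * 3/2 + 832 = 1456\<close>.
\<close>
lemma sup_bound_step:
  fixes c c' :: "int ^ 3 \<Rightarrow> complex" and N :: nat
  defines "g \<equiv> fourier_coeff (\<lambda>x. nonlin (trig_poly N c x))"
  assumes \<nu>: "0 < \<nu>" and \<tau>: "0 < \<tau>" and h: "hermitian_coeffs c" and c0: "c 0 = 0"
    and step: "\<And>k. k \<in> freqs N \<Longrightarrow>
      c' k - c k = - of_real (\<tau> * eigenval k) * (of_real (\<nu> * eigenval k) * c' k + g k)"
    and M: "M = 2/3 * sqrt (2 * \<nu> / \<tau>)"
    and bound: "AE x in torus_measure. (trig_poly N c x)\<^sup>2 \<le> M"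
    and E: "energy \<nu> (trig_poly N c) \<le> E" "0 \<le> E"
    and small: "(2000 * E) ^ 4 * \<tau> \<le> \<nu> ^ 7"
  shows "(trig_poly N c' x)\<^sup>2 \<le> M"
proof -
  define a where "a = root 4 (\<tau> * \<nu>)"
  have a: "0 < a" using \<nu> \<tau> by (simp add: a_def)
  have a4: "a ^ 4 = \<tau> * \<nu>" using \<nu> \<tau> by (simp add: a_def)
  have \<tau>_eq: "\<tau> = a ^ 4 / \<nu>" using a4 \<nu> by simp
  define q where "q = E * a / \<nu>\<^sup>2"
  have "2 * \<nu> / \<tau> = 2 * (\<nu> / a\<^sup>2)\<^sup>2"
    using \<nu> a by (simp add: \<tau>_eq power2_eq_square eval_nat_numeral)
  then have M_eq: "M = 2/3 * sqrt 2 * (\<nu> / a\<^sup>2)"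
    unfolding M using \<nu> by (simp add: real_sqrt_mult)
  have "1 \<le> sqrt 2" by simp
  then have "1 * (\<nu> / a\<^sup>2) \<le> sqrt 2 * (\<nu> / a\<^sup>2)"
    using \<nu> by (intro mult_right_mono) auto
  then have p: "\<nu> / a\<^sup>2 \<le> 3/2 * M" unfolding M_eq by (simp add: mult_ac)
  have M0: "0 \<le> M" unfolding M_eq using \<nu> by simp
  have q: "0 \<le> q" unfolding q_def using E a by simp
  have "(2000 * q) ^ 4 = (2000 * E) ^ 4 * a ^ 4 / \<nu> ^ 8"
    by (simp add: q_def power_mult_distrib power_divide)
  also have "\<dots> = (2000 * E) ^ 4 * \<tau> / \<nu> ^ 7"
    using \<nu> unfolding a4 by (simp add: eval_nat_numeral)
  also have "\<dots> \<le> 1 ^ 4" using small \<nu> by (simp add: divide_le_eq)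
  finally have q1: "2000 * q \<le> 1" using power_mono_iff[of "2000 * q" 1 4] q by simp
  have cont: "continuous_on UNIV (\<lambda>x. nonlin (trig_poly N c x))"
    unfolding nonlin_def by (intro continuous_intros)
  have "(\<Sum>k\<in>freqs N. eigenval k * (norm (c k))\<^sup>2) \<le> 2 * energy \<nu> (trig_poly N c) / \<nu>"
    by (rule energy_parts_le(1)[OF h \<nu>])
  also have "\<dots> \<le> 2 * E / \<nu>" using E \<nu> by (simp add: divide_right_mono)
  finally have A: "(\<Sum>k\<in>freqs N. eigenval k * (norm (c k))\<^sup>2) \<le> 2 * E / \<nu>" .
  have "(\<Sum>k\<in>freqs N. (norm (g k))\<^sup>2) \<le> (\<integral>x. (nonlin (trig_poly N c x))\<^sup>2 \<partial>torus_measure)"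
    unfolding g_def by (rule bessel[OF cont])
  also have "\<dots> \<le> 4 * energy \<nu> (trig_poly N c) * M"
    by (rule integral_nonlin_squared_le[OF h \<nu> M0 bound])
  also have "\<dots> \<le> 4 * E * M" using E M0 by (intro mult_right_mono) auto
  finally have B: "(\<Sum>k\<in>freqs N. (norm (g k))\<^sup>2) \<le> 4 * E * M" .
  have step': "of_real (1 + a ^ 4 * (eigenval k)\<^sup>2) * c' k = c k - of_real (\<tau> * eigenval k) * g k"
    if "k \<in> freqs N" for k
    using step[OF that] unfolding a4 by (simp add: algebra_simps power2_eq_square)
  have "(trig_poly N c' x)\<^sup>2 \<le> (\<Sum>k\<in>freqs N. norm (c' k))\<^sup>2"
    using abs_trig_poly_le by (intro power2_le_iff_abs_le[THEN iffD2] sum_nonneg) auto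
  also have "\<dots> \<le> 208 * (2 * E / \<nu>) / a + 208 * \<tau>\<^sup>2 * (4 * E * M) / a ^ 7"
    by (rule step_norm_bound[OF a \<tau> c0 step' A B])
  also have "\<dots> = 416 * q * (\<nu> / a\<^sup>2) + 832 * q * M"
    using a \<nu> by (simp add: q_def \<tau>_eq power2_eq_square eval_nat_numeral)
  also have "\<dots> \<le> 416 * q * (3/2 * M) + 832 * q * M"
    using p q by (intro add_right_mono mult_left_mono) auto
  also have "\<dots> = 1456 * q * M" by simp
  also have "\<dots> \<le> 1 * M" using q1 q M0 by (intro mult_right_mono) auto
  finally show ?thesis by simp
qed

section \<open>Energy stability of the scheme\<close>

text \<open>
  The invariant carried through the induction is: zero mean, \<open>u\<^sup>2 \<le> M\<close> almost everywhere, and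
  energy at most that of the initial datum. The supremum bound for the next iterate comes before the
  energy estimate, which needs it for both iterates.
\<close>
lemma scheme_energy_decreasing:
  assumes \<nu>: "0 < \<nu>" and \<tau>: "0 < \<tau>" and mean: "torus_integral u0 = 0"
    and sup: "Linf_norm (proj N u0) = ereal L0" and L0: "9 * L0 ^ 4 * \<tau> \<le> 8 * \<nu>"
    and small: "(2000 * energy \<nu> (proj N u0)) ^ 4 * \<tau> \<le> \<nu> ^ 7"
    and scheme: "scheme_solution \<nu> \<tau> N u0 u"
  shows "energy \<nu> (u (Suc n)) \<le> energy \<nu> (u n)"
proof -
  define M where "M = 2/3 * sqrt (2 * \<nu> / \<tau>)"
  define E where "E = energy \<nu> (proj N u0)"
  have E0: "0 \<le> E" unfolding E_def by (rule energy_nonneg[OF \<nu>])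
  define P where "P n \<longleftrightarrow> (\<exists>c. hermitian_coeffs c \<and> c 0 = 0 \<and> u n = trig_poly N c) \<and>
    (AE x in torus_measure. (u n x)\<^sup>2 \<le> M) \<and> energy \<nu> (u n) \<le> E" for n
  have P0: "P 0"
  proof -
    have u0: "u 0 = proj N u0" using scheme by (simp add: scheme_solution_def)
    have "fourier_coeff u0 0 = 0"
      using mean by (simp add: fourier_coeff_eq torus_integral_eq)
    then have "\<exists>c. hermitian_coeffs c \<and> c 0 = 0 \<and> u 0 = trig_poly N c"
      unfolding u0 proj_eq_trig_poly using hermitian_fourier_coeff by blast
    moreover have "AE x in torus_measure. (u 0 x)\<^sup>2 \<le> M"
    proof -
      have "(L0\<^sup>2)\<^sup>2 \<le> M\<^sup>2"
        using L0 \<tau> \<nu> unfolding M_def by (simp add: power_mult_distrib field_simps)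
      then have LM: "L0\<^sup>2 \<le> M"
        by (rule power2_le_imp_le) (use \<tau> \<nu> in \<open>simp add: M_def\<close>)
      have "AE x in torus_measure. ereal \<bar>u 0 x\<bar> \<le> ereal L0"
        using esssup_AE[of "\<lambda>x. ereal \<bar>u 0 x\<bar>" torus_measure] sup unfolding u0 Linf_norm_def by simp
      then show ?thesis
      proof eventually_elim
        fix x assume "ereal \<bar>u 0 x\<bar> \<le> ereal L0"
        then have "(u 0 x)\<^sup>2 \<le> L0\<^sup>2" by (intro abs_le_square_iff[THEN iffD1]) simp
        with LM show "(u 0 x)\<^sup>2 \<le> M" by simp
      qed
    qed
    ultimately show ?thesis by (simp add: P_def u0 E_def)
  qed
  have step: "P (Suc n) \<and> energy \<nu> (u (Suc n)) \<le> energy \<nu> (u n)" if Pn: "P n" for n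
  proof -
    obtain c where c: "hermitian_coeffs c" "c 0 = 0" "u n = trig_poly N c"
      using Pn unfolding P_def by blast
    then have bound: "AE x in torus_measure. (trig_poly N c x)\<^sup>2 \<le> M" and E: "energy \<nu> (trig_poly N c) \<le> E"
      using Pn by (simp_all add: P_def)
    have "u (Suc n) \<in> X_space N" using scheme by (simp add: scheme_solution_def)
    then obtain c' where c': "hermitian_coeffs c'" "u (Suc n) = trig_poly N c'"
      by (rule X_space_trig_poly)
    have eq: "(trig_poly N c' x - trig_poly N c x) / \<tau> =
        - \<nu> * laplacian (laplacian (trig_poly N c')) x
        + laplacian (trig_poly N (fourier_coeff (\<lambda>y. nonlin (trig_poly N c y)))) x" for x
      using scheme unfolding scheme_solution_def proj_eq_trig_poly by (metis c(3) c'(2))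
    note coeffs = scheme_coeffs[OF \<tau> c(1) c'(1) hermitian_fourier_coeff eq]
    have bound': "(trig_poly N c' x)\<^sup>2 \<le> M" for x
      by (rule sup_bound_step[OF \<nu> \<tau> c(1,2) coeffs M_def bound E E0 small[folded E_def]])
    have "energy \<nu> (trig_poly N c') \<le> energy \<nu> (trig_poly N c)"
      using \<tau> \<nu> by (intro energy_step[OF \<nu> \<tau> c(1) c'(1) coeffs _ bound AE_I2[OF bound']]) (simp_all add: M_def)
    moreover have "c' 0 = 0" using coeffs[of 0] c(2) by simp
    ultimately show ?thesis
      using c c' bound' E by (auto simp: P_def)
  qed
  have "P n" by (induction n) (use P0 step in auto)
  then show ?thesis using step by blast
qed

theorem theorem6p4:
  shows "\<exists>B3 B4 B5 :: real. B3 > 0 \<and> B4 > 0 \<and> B5 > 0 \<and>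
    (\<forall>(\<nu> :: real) (N :: nat) (u0 :: real ^ 3 \<Rightarrow> real) (L0 :: real).
      \<nu> > 0 \<and> N \<ge> 2 \<and> H1_torus u0 \<and> torus_integral u0 = 0 \<and>
      Linf_norm (proj N u0) = ereal L0 \<and> L0 \<noteq> 0 \<longrightarrow>
      (let E0 = energy \<nu> (proj N u0);
           \<beta>3 = B3 * sqrt E0;
           \<beta>4 = B4 * E0 powr (3/2);
           \<beta>5 = B5 * (1 + E0) powr (1/4);
           \<tau>max1 = 0.0007 * \<nu> ^ 7 *
                     min (\<beta>3 powr (-8)) (min (\<beta>4 powr (-8/3)) (\<beta>5 powr (-8)));
           \<tau>max = min (8 * \<nu> / (9 * L0 ^ 4)) \<tau>max1
       in \<forall>(\<tau> :: real) (u :: nat \<Rightarrow> real ^ 3 \<Rightarrow> real).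
            0 < \<tau> \<and> \<tau> \<le> \<tau>max \<and> scheme_solution \<nu> \<tau> N u0 u \<longrightarrow>
            (\<forall>n. energy \<nu> (u (Suc n)) \<le> energy \<nu> (u n))))"
proof (rule exI[of _ 100], rule exI[of _ 1], rule exI[of _ 1], unfold Let_def, intro conjI allI impI, goal_cases)
  case (4 \<nu> N u0 L0 \<tau> u n)
  let ?E = "energy \<nu> (proj N u0)"
  have \<nu>: "0 < \<nu>" and \<tau>: "0 < \<tau>" and L0: "L0 \<noteq> 0" using 4 by auto
  have t1: "\<tau> \<le> 8 * \<nu> / (9 * L0 ^ 4)" using 4 by auto
  have "\<tau> \<le> 0.0007 * \<nu> ^ 7 * min ((100 * sqrt ?E) powr (-8))
      (min ((1 * ?E powr (3/2)) powr (-8/3)) ((1 * (1 + ?E) powr (1/4)) powr (-8)))"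
    using 4 by auto
  also have "\<dots> \<le> 0.0007 * \<nu> ^ 7 * (100 * sqrt ?E) powr (-8)"
    using \<nu> by (intro mult_left_mono) auto
  finally have t2: "\<tau> \<le> 0.0007 * \<nu> ^ 7 * (100 * sqrt ?E) powr (-8)" .
  \<comment> \<open>For vanishing energy \<open>\<beta>\<^sub>3 = 0\<close>, and \<open>0 powr (-8) = 0\<close> leaves no admissible \<open>\<tau>\<close>.\<close>
  have E: "0 < ?E"
  proof (rule ccontr)
    assume "\<not> 0 < ?E"
    with energy_nonneg[OF \<nu>, of "proj N u0"] have "?E = 0" by simp
    with t2 \<tau> show False by simp
  qed
  have "sqrt ?E ^ 8 = (sqrt ?E ^ 2) ^ 4" by (simp flip: power_mult)
  then have "(100 * sqrt ?E) ^ 8 = 100 ^ 8 * ?E ^ 4" using E by (simp add: power_mult_distrib)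
  then have "(100 * sqrt ?E) powr (-8) = 1 / (100 ^ 8 * ?E ^ 4)"
    using E by (simp add: powr_minus_divide powr_numeral)
  with t2 have "\<tau> \<le> 0.0007 * \<nu> ^ 7 / (100 ^ 8 * ?E ^ 4)" by simp
  then have "100 ^ 8 * ?E ^ 4 * \<tau> \<le> 0.0007 * \<nu> ^ 7"
    using E by (simp add: field_simps)
  moreover have "0 < \<nu> ^ 7" "0 \<le> ?E ^ 4 * \<tau>" using \<nu> \<tau> by auto
  \<comment> \<open>\<open>2000\<^sup>4 * 0.0007 \<le> 100\<^sup>8\<close>, which is why \<open>B\<^sub>3 = 100\<close> suffices.\<close>
  ultimately have small: "(2000 * ?E) ^ 4 * \<tau> \<le> \<nu> ^ 7"
    by (simp add: power_mult_distrib mult.assoc)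
  have "9 * L0 ^ 4 * \<tau> \<le> 8 * \<nu>" using t1 L0 by (simp add: field_simps)
  with 4 \<nu> \<tau> small show ?case by (intro scheme_energy_decreasing) auto
qed auto

end
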